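(* Let $d\ge 1$, let $\delta>0$, and let $\mu$ be a $\delta$-ULC probability measure on $\mathbb N^d$. Then $\mu$ satisfies the weighted Poincaré inequality with constant $\delta$: $$\delta\,\mathrm{Var}_\mu[f]\;\le\;\mathbf E_{\mathbf n\sim\mu}\Big[\sum_{i=1}^d \frac{(n_i+1)\,\mu(\mathbf n+\mathbf e_i)}{\mu(\mathbf n)}\,\big(\nabla_i^+f(\mathbf n)\big)^2\Big]\qquad\text{for all } f\in\mathcal D(\mathcal E).$$ Equivalently, the birth-death generator $\mathcal L$ associated with $\mu$ has spectral gap at least $\delta$.
   Context: $\mathbb N=\{0,1,2,\dots\}$, $[d]=\{1,\dots,d\}$, $\mathbf e_i$ is the $i$-th standard basis vector, $\mathbf n!=\prod_{i=1}^d n_i!$, and $\preceq,\succeq$ denote the positive semidefinite order. A set $S\subseteq\mathbb N^d$ is downward closed if $\mathbf n\in S$ and $\mathbf 0\le\mathbf m\le\mathbf n$ (coordinatewise) imply $\mathbf m\in S$. For a probability measure $\mu$ on $\mathbb N^d$, $\mathrm{supp}(\mu)=\{\mathbf n:\mu(\mathbf n)>0\}$. Definition ($\delta$-ULC). Let $\mu$ be a probability measure on $\mathbb N^d$ with downward closed support. Put $a(\mathbf n)=\mathbf n!\,\mu(\mathbf n)$ and, for $\mathbf n\in\mathrm{supp}(\mu)$, $\mathcal I_{\mathbf n}=\{i\in[d]:\mathbf n+\mathbf e_i\in\mathrm{supp}(\mu)\}$. For $\delta>0$, $\mu$ is $\delta$-ULC ($\delta$-ultra-log-concave) if for every $\mathbf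 n\in\mathrm{supp}(\mu)$ $$\Big(1-\frac{a(\mathbf n)\,a(\mathbf n+\mathbf e_i+\mathbf e_j)}{a(\mathbf n+\mathbf e_i)\,a(\mathbf n+\mathbf e_j)}\Big)_{i,j\in\mathcal I_{\mathbf n}}+(1-\delta)\,\mathrm{diag}\Big(\frac{a(\mathbf n)}{a(\mathbf n+\mathbf e_i)}\Big)_{i\in\mathcal I_{\mathbf n}}\succeq 0 .$$ For $f:\mathrm{supp}(\mu)\to\mathbb R$: $\nabla_i^+f(\mathbf n)=f(\mathbf n+\mathbf e_i)-f(\mathbf n)$ and $\nabla_i^-f(\mathbf n)=f(\mathbf n-\mathbf e_i)-f(\mathbf n)$; any term in which the neighbour lies outside $\mathrm{supp}(\mu)$ comes with rate $0$ and is interpreted as $0$. The birth-death generator is $$\mathcal Lf(\mathbf n)=\sum_{i=1}^d\frac{(n_i+1)\mu(\mathbf n+\mathbf e_i)}{\mu(\mathbf n)}\nabla_i^+f(\mathbf n)+\sum_{i=1}^d n_i\nabla_i^-f(\mathbf n),$$ which is reversible with respect to $\mu$, with Dirichlet form $\mathcal E(f,g)=\mathbf E_{\mathbf n\sim\mu}\big[\sum_{i=1}^d\frac{(n_i+1)\mu(\mathbf n+\mathbf e_i)}{\mu(\mathbf n)}\nabla_i^+f(\mathbf n)\nabla_i^+g(\mathbf n)\big]$ and energy domain $\mathcal D(\mathcal E)=\{f\in L^2(\mu):\mathcal E(f,f)<\infty\}$. The spectral gap of $\mathcal L$ is the largest $\gamma$ such that $\gamma\,\mathrm{Var}_\mu[f]\le\mathcal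 E(f,f)$ for all $f\in\mathcal D(\mathcal E)$. *)

theory Defs
  imports "HOL-Probability.Probability"
begin

text \<open>
  Points of \<open>\<nat>\<^sup>d\<close> have type \<open>nat ^ 'd\<close>, with the coordinatewise order of the library; the
  basis vector \<open>e\<^sub>i\<close> is \<open>axis i 1\<close>. A probability measure on the countable set
  \<open>\<nat>\<^sup>d\<close> is a \<open>pmf\<close>, whose support is \<open>set_pmf\<close>.

  Functions on the support are represented by total functions on \<open>nat ^ 'd\<close>. Their values
  outside the support are irrelevant: they only ever occur multiplied by a rate or a probability
  that is \<open>0\<close>.
\<close>

definition downward_closed :: "(nat ^ 'd) set \<Rightarrow> bool" where
  "downward_closed S \<longleftrightarrow> (\<forall>n\<in>S. \<forall>m. m \<le> n \<longrightarrow> m \<in> S)"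

definition psd_on :: "'i set \<Rightarrow> ('i \<Rightarrow> 'i \<Rightarrow> real) \<Rightarrow> bool" where
  "psd_on I M \<longleftrightarrow> (\<forall>i\<in>I. \<forall>j\<in>I. M i j = M j i) \<and>
     (\<forall>v :: 'i \<Rightarrow> real. 0 \<le> (\<Sum>i\<in>I. \<Sum>j\<in>I. v i * M i j * v j))"

definition weight :: "(nat ^ 'd) pmf \<Rightarrow> nat ^ 'd \<Rightarrow> real" where
  "weight \<mu> n = (\<Prod>i\<in>UNIV. fact (n $ i)) * pmf \<mu> n"

definition up_dirs :: "(nat ^ 'd) pmf \<Rightarrow> nat ^ 'd \<Rightarrow> 'd set" where
  "up_dirs \<mu> n = {i. n + axis i 1 \<in> set_pmf \<mu>}"

definition ulc :: "real \<Rightarrow> (nat ^ 'd) pmf \<Rightarrow> bool" where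
  "ulc \<delta> \<mu> \<longleftrightarrow> downward_closed (set_pmf \<mu>) \<and>
     (\<forall>n\<in>set_pmf \<mu>. psd_on (up_dirs \<mu> n) (\<lambda>i j.
        (1 - weight \<mu> n * weight \<mu> (n + axis i 1 + axis j 1) /
               (weight \<mu> (n + axis i 1) * weight \<mu> (n + axis j 1))) +
        (1 - \<delta>) * (if i = j then weight \<mu> n / weight \<mu> (n + axis i 1) else 0)))"

definition grad_up :: "'d::finite \<Rightarrow> (nat ^ 'd \<Rightarrow> real) \<Rightarrow> nat ^ 'd \<Rightarrow> real" where
  "grad_up i f n = f (n + axis i 1) - f n"

text \<open>
  Subtraction on \<open>nat ^ 'd\<close> is truncated, which is harmless below: \<open>grad_down i f n\<close> is always
  multiplied by \<open>n $ i\<close>.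
\<close>

definition grad_down :: "'d::finite \<Rightarrow> (nat ^ 'd \<Rightarrow> real) \<Rightarrow> nat ^ 'd \<Rightarrow> real" where
  "grad_down i f n = f (n - axis i 1) - f n"

definition birth_rate :: "(nat ^ 'd) pmf \<Rightarrow> 'd::finite \<Rightarrow> nat ^ 'd \<Rightarrow> real" where
  "birth_rate \<mu> i n = (real (n $ i) + 1) * pmf \<mu> (n + axis i 1) / pmf \<mu> n"

definition generator ::
    "(nat ^ 'd::finite) pmf \<Rightarrow> (nat ^ 'd \<Rightarrow> real) \<Rightarrow> nat ^ 'd \<Rightarrow> real" where
  "generator \<mu> f n = (\<Sum>i\<in>UNIV. birth_rate \<mu> i n * grad_up i f n) +
                     (\<Sum>i\<in>UNIV. real (n $ i) * grad_down i f n)"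

definition energy_density ::
    "(nat ^ 'd::finite) pmf \<Rightarrow> (nat ^ 'd \<Rightarrow> real) \<Rightarrow> (nat ^ 'd \<Rightarrow> real) \<Rightarrow> nat ^ 'd \<Rightarrow> real" where
  "energy_density \<mu> f g n = (\<Sum>i\<in>UNIV. birth_rate \<mu> i n * grad_up i f n * grad_up i g n)"

definition dirichlet ::
    "(nat ^ 'd::finite) pmf \<Rightarrow> (nat ^ 'd \<Rightarrow> real) \<Rightarrow> (nat ^ 'd \<Rightarrow> real) \<Rightarrow> real" where
  "dirichlet \<mu> f g = measure_pmf.expectation \<mu> (energy_density \<mu> f g)"

text \<open>
  The energy density of \<open>(f, f)\<close> is nonnegative, so its integrability says that the energy of \<open>f\<close>
  is finite.
\<close>

definition energy_domain :: "(nat ^ 'd::finite) pmf \<Rightarrow> (nat ^ 'd \<Rightarrow> real) set" where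
  "energy_domain \<mu> = {f. integrable (measure_pmf \<mu>) (\<lambda>n. (f n)\<^sup>2) \<and>
                         integrable (measure_pmf \<mu>) (energy_density \<mu> f f)}"

text \<open>
  The spectral gap of \<open>generator \<mu>\<close>. The supremum is taken in the extended reals because the gap
  is \<open>\<infinity>\<close> if \<open>\<mu>\<close> is a point mass; whenever it is finite it is attained.
\<close>

definition spectral_gap :: "(nat ^ 'd::finite) pmf \<Rightarrow> ereal" where
  "spectral_gap \<mu> = Sup {ereal \<gamma> | \<gamma>. \<forall>f\<in>energy_domain \<mu>.
                            \<gamma> * measure_pmf.variance \<mu> f \<le> dirichlet \<mu> f f}"

text \<open>
  On finitely supported functions \<open>dirichlet\<close> is the quadratic form of \<open>- generator\<close>.
\<close>

lemma dirichlet_eq_generator: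
  fixes \<mu> :: "(nat ^ 'd::finite) pmf"
  assumes dc: "downward_closed (set_pmf \<mu>)" and fin: "finite {n. f n \<noteq> 0}"
  shows "dirichlet \<mu> f g = measure_pmf.expectation \<mu> (\<lambda>n. - f n * generator \<mu> g n)"
proof -
  define A where "A = {n. f n \<noteq> 0}"
  define C where "C = A \<union> (\<Union>i. (\<lambda>n. n - axis i 1) ` A)"
  have finC: "finite C"
    using fin by (auto simp: C_def A_def)
  define r where "r i n = (real (n $ i) + 1) * pmf \<mu> (n + axis i 1)" for i n
  have rate: "birth_rate \<mu> i n * pmf \<mu> n = r i n" for i n
  proof (cases "n \<in> set_pmf \<mu>")
    case True
    then show ?thesis by (simp add: birth_rate_def r_def set_pmf_iff)
  next
    case False
    have "n \<le> n + axis i 1" by (simp add: less_eq_vec_def)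
    with False dc have "n + axis i 1 \<notin> set_pmf \<mu>"
      unfolding downward_closed_def by blast
    with False show ?thesis by (simp add: birth_rate_def r_def set_pmf_iff)
  qed
  have sub_add: "n + axis i 1 - axis i 1 = n" for n :: "nat ^ 'd" and i
    by (simp add: vec_eq_iff)
  have add_sub: "n - axis i 1 + axis i 1 = n" if "0 < n $ i" for n :: "nat ^ 'd" and i
    using that by (auto simp: vec_eq_iff axis_def)
  have "dirichlet \<mu> f g = (\<Sum>n\<in>C. energy_density \<mu> f g n * pmf \<mu> n)"
    unfolding dirichlet_def
  proof (rule integral_measure_pmf_real[OF finC])
    fix n assume "energy_density \<mu> f g n \<noteq> 0"
    then obtain i where "grad_up i f n \<noteq> 0"
      unfolding energy_density_def by (metis (no_types, lifting) mult_eq_0_iff sum.neutral)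
    then have "n \<in> A \<or> n + axis i 1 \<in> A" by (auto simp: A_def grad_up_def)
    then show "n \<in> C"
    proof
      assume "n + axis i 1 \<in> A"
      then have "n \<in> (\<lambda>n. n - axis i 1) ` A" by (metis imageI sub_add)
      then show ?thesis by (auto simp: C_def)
    qed (simp add: C_def)
  qed
  also have "\<dots> = (\<Sum>n\<in>C. \<Sum>i\<in>UNIV. r i n * grad_up i f n * grad_up i g n)"
    by (simp add: energy_density_def sum_distrib_right flip: rate) (simp add: mult_ac)
  finally have lhs: "dirichlet \<mu> f g =
      (\<Sum>i\<in>UNIV. \<Sum>n\<in>C. r i n * grad_up i f n * grad_up i g n)"
    by (simp add: sum.swap[of _ UNIV C])
  have "measure_pmf.expectation \<mu> (\<lambda>n. - f n * generator \<mu> g n) =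
      (\<Sum>n\<in>C. - f n * generator \<mu> g n * pmf \<mu> n)"
    by (rule integral_measure_pmf_real[OF finC]) (auto simp: C_def A_def)
  also have "\<dots> = (\<Sum>n\<in>C. (\<Sum>i\<in>UNIV. - f n * r i n * grad_up i g n) +
      (\<Sum>i\<in>UNIV. - f n * real (n $ i) * pmf \<mu> n * grad_down i g n))"
    by (simp add: generator_def sum_distrib_right sum_distrib_left algebra_simps sum_negf
        flip: rate)
  finally have rhs: "measure_pmf.expectation \<mu> (\<lambda>n. - f n * generator \<mu> g n) =
      (\<Sum>i\<in>UNIV. (\<Sum>n\<in>C. - f n * r i n * grad_up i g n) +
        (\<Sum>n\<in>C. - f n * real (n $ i) * pmf \<mu> n * grad_down i g n))"
    by (simp add: sum.distrib sum.swap[of _ UNIV C])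
  have shift: "(\<Sum>n\<in>C. - f n * real (n $ i) * pmf \<mu> n * grad_down i g n) =
      (\<Sum>n\<in>C. f (n + axis i 1) * r i n * grad_up i g n)" for i
  proof -
    let ?S = "{n\<in>C. f n \<noteq> 0 \<and> n $ i \<noteq> 0}" and ?T = "{n\<in>C. f (n + axis i 1) \<noteq> 0}"
    have "(\<Sum>n\<in>C. - f n * real (n $ i) * pmf \<mu> n * grad_down i g n) =
        (\<Sum>n\<in>?S. - f n * real (n $ i) * pmf \<mu> n * grad_down i g n)"
      by (rule sum.mono_neutral_right) (use finC in auto)
    also have "\<dots> = (\<Sum>n\<in>?T. f (n + axis i 1) * r i n * grad_up i g n)"
    proof (rule sum.reindex_bij_witness
        [where i = "\<lambda>n. n + axis i 1" and j = "\<lambda>n. n - axis i 1"])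
      fix n assume n: "n \<in> ?S"
      show "n - axis i 1 + axis i 1 = n" using n add_sub by simp
      show "n - axis i 1 \<in> ?T"
        using n add_sub[of n i] by (auto simp: C_def A_def)
      have "0 < n $ i" using n by auto
      then show "f (n - axis i 1 + axis i 1) * r i (n - axis i 1) * grad_up i g (n - axis i 1) =
          - f n * real (n $ i) * pmf \<mu> n * grad_down i g n"
        using add_sub[of n i]
        by (simp add: r_def grad_up_def grad_down_def algebra_simps of_nat_diff)
    next
      fix n assume n: "n \<in> ?T"
      show "n + axis i 1 - axis i 1 = n" by (rule sub_add)
      show "n + axis i 1 \<in> ?S" using n by (auto simp: C_def A_def)
    qed
    also have "\<dots> = (\<Sum>n\<in>C. f (n + axis i 1) * r i n * grad_up i g n)"
      by (rule sum.mono_neutral_left) (use finC in auto)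
    finally show ?thesis .
  qed
  show ?thesis
    unfolding lhs rhs shift sum.distrib[symmetric]
    by (simp add: grad_up_def algebra_simps)
qed

end

theory Submission
  imports Defs
begin

text \<open>
  For finite support, expanding \<open>L\<close> and shifting sums gives the Bochner identity
  \<open>E[(L f)\<^sup>2] = E[\<Sum>\<^sub>i\<^sub>j (b\<^sub>i b\<^sub>j - q\<^sub>i\<^sub>j) u\<^sub>i u\<^sub>j + \<Sum>\<^sub>i b\<^sub>i u\<^sub>i\<^sup>2 + \<Sum>\<^sub>i\<^sub>j q\<^sub>i\<^sub>j (\<nabla>\<^sub>j u\<^sub>i)\<^sup>2]\<close> with \<open>u\<^sub>i = \<nabla>\<^sub>i f\<close>,
  \<open>b\<^sub>i = a(n + e\<^sub>i) / a(n)\<close> and \<open>q\<^sub>i\<^sub>j = a(n + e\<^sub>i + e\<^sub>j) / a(n)\<close>. The ULC matrix tested against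
  \<open>b\<^sub>i u\<^sub>i\<close> turns this into \<open>\<delta> E(f, f) \<le> E[(L f)\<^sup>2]\<close>; applied to a minimiser of the Rayleigh
  quotient, which satisfies \<open>- L f = \<kappa> f\<close>, this yields \<open>\<delta> \<le> \<kappa>\<close>. If \<open>\<delta> > 1\<close> the support is finite.
  If \<open>\<delta> \<le> 1\<close>, restricting \<open>\<mu>\<close> to \<open>{n. \<bar>n\<bar> \<le> k}\<close> preserves the ULC condition, because on the new
  boundary \<open>q\<^sub>i\<^sub>j\<close> becomes \<open>0\<close>; then let \<open>k \<rightarrow> \<infinity>\<close>.
\<close>

section \<open>Flows and the curvature condition\<close>

text \<open>
  In terms of \<open>b\<close> and \<open>q\<close> above, \<open>up_flow m i = m b\<^sub>i\<close> and \<open>up_flow2 m i j = m q\<^sub>i\<^sub>j\<close>, but without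
  division, so that both vanish when the target point lies outside the support.
\<close>

definition up_flow :: "(nat ^ 'd::finite \<Rightarrow> real) \<Rightarrow> 'd \<Rightarrow> nat ^ 'd \<Rightarrow> real" where
  "up_flow m i n = (real (n $ i) + 1) * m (n + axis i 1)"

definition up_flow2 :: "(nat ^ 'd::finite \<Rightarrow> real) \<Rightarrow> 'd \<Rightarrow> 'd \<Rightarrow> nat ^ 'd \<Rightarrow> real" where
  "up_flow2 m i j n = (real (n $ i) + 1) * up_flow m j (n + axis i 1)"

text \<open>The quadratic form of the ULC matrix at \<open>n\<close>, tested against
  \<open>up_flow m i n * u i\<close> and divided by \<open>m n\<close>. Directions leaving the
  support then contribute \<open>0\<close>, so the sums can run over all directions.\<close>

definition curved :: "real \<Rightarrow> (nat ^ 'd::finite \<Rightarrow> real) \<Rightarrow> nat ^ 'd \<Rightarrow> bool" where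
  "curved \<delta> m n \<longleftrightarrow> (\<forall>u. 0 \<le>
     (\<Sum>i\<in>UNIV. \<Sum>j\<in>UNIV. (up_flow m i n * up_flow m j n / m n - up_flow2 m i j n) * (u i * u j)) +
     (1 - \<delta>) * (\<Sum>i\<in>UNIV. up_flow m i n * (u i)\<^sup>2))"

lemma up_flow2_commute: "up_flow2 m i j n = up_flow2 m j i n"
  by (cases "i = j") (auto simp: up_flow2_def up_flow_def axis_def ac_simps)

lemma add_axis_diff: "n + axis i 1 - axis i 1 = (n :: nat ^ 'd::finite)"
  by (simp add: vec_eq_iff)

lemma diff_axis_add: "0 < n $ i \<Longrightarrow> n - axis i 1 + axis i 1 = (n :: nat ^ 'd::finite)"
  by (auto simp: vec_eq_iff axis_def)

lemma le_add_axis: "n \<le> n + axis i (1::nat)" for n :: "nat ^ 'd::finite"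
  by (simp add: less_eq_vec_def)

text \<open>Both sides are the same mixed second difference of \<open>f\<close>;
  \<open>bochner\<close> uses this to write its square as a product of two differently expanded
  factors.\<close>

lemma grad_up_shift:
  "grad_up i f (n + axis j 1) - grad_up i f n = grad_up j f (n + axis i 1) - grad_up j f n"
  by (simp add: grad_up_def ac_simps)

section \<open>Summation by parts on finite down-sets\<close>

locale finite_weight =
  fixes m :: "nat ^ 'd::finite \<Rightarrow> real" and S :: "(nat ^ 'd) set"
  assumes finite_S: "finite S"
    and dc: "downward_closed S"
    and pos: "n \<in> S \<Longrightarrow> 0 < m n"
    and zero: "n \<notin> S \<Longrightarrow> m n = 0"
begin

lemma nonneg: "0 \<le> m n"
  by (cases "n \<in> S") (auto simp: zero dest: pos)

lemma up_flow_nonneg: "0 \<le> up_flow m i n"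
  by (simp add: up_flow_def nonneg)

lemma down_axis: "n + axis i 1 \<in> S \<Longrightarrow> n \<in> S"
  using dc le_add_axis unfolding downward_closed_def by blast

text \<open>Detailed balance in summed form: deaths at rate \<open>n $ i\<close> match births one
  step lower. Points with \<open>n $ i = 0\<close> and steps leaving \<open>S\<close> carry weight
  \<open>0\<close>, and downward closure keeps \<open>n - axis i 1\<close> in
  \<open>S\<close>.\<close>

lemma sum_shift:
  "(\<Sum>n\<in>S. real (n $ i) * m n * g n) = (\<Sum>n\<in>S. up_flow m i n * g (n + axis i 1))"
proof -
  let ?A = "{n\<in>S. 0 < n $ i}" and ?B = "{n\<in>S. n + axis i 1 \<in> S}"
  have "(\<Sum>n\<in>S. real (n $ i) * m n * g n) = (\<Sum>n\<in>?A. real (n $ i) * m n * g n)"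
    by (rule sum.mono_neutral_right) (use finite_S in auto)
  also have "\<dots> = (\<Sum>n\<in>?B. up_flow m i n * g (n + axis i 1))"
  proof (rule sum.reindex_bij_witness[where i = "\<lambda>n. n + axis i 1" and j = "\<lambda>n. n - axis i 1"])
    fix n assume n: "n \<in> ?A"
    show "n - axis i 1 + axis i 1 = n" using n diff_axis_add by auto
    then show "n - axis i 1 \<in> ?B" using n down_axis[of "n - axis i 1" i] by auto
    show "up_flow m i (n - axis i 1) * g (n - axis i 1 + axis i 1) = real (n $ i) * m n * g n"
      using n diff_axis_add[of n i] by (simp add: up_flow_def of_nat_diff)
  next
    fix n assume n: "n \<in> ?B"
    show "n + axis i 1 - axis i 1 = n" by (rule add_axis_diff)
    show "n + axis i 1 \<in> ?A" using n by auto
  qed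
  also have "\<dots> = (\<Sum>n\<in>S. up_flow m i n * g (n + axis i 1))"
    by (rule sum.mono_neutral_left) (use finite_S in \<open>auto simp: up_flow_def zero\<close>)
  finally show ?thesis .
qed

text \<open>Cancels the rate denominator at the shifted point. If that point lies outside
  \<open>S\<close>, so does the next one by downward closure, and both sides are
  \<open>0\<close>.\<close>

lemma up_flow_divide: "up_flow m i n * (up_flow m j (n + axis i 1) / m (n + axis i 1)) = up_flow2 m i j n"
proof (cases "n + axis i 1 \<in> S")
  case True
  then show ?thesis using pos[OF True] by (simp add: up_flow2_def up_flow_def[of m i])
next
  case False
  then have "n + axis i 1 + axis j 1 \<notin> S" using down_axis by blast
  then show ?thesis using False by (simp add: up_flow2_def up_flow_def zero)
qed

definition birth :: "(nat ^ 'd \<Rightarrow> real) \<Rightarrow> nat ^ 'd \<Rightarrow> real" where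
  "birth f n = (\<Sum>i\<in>UNIV. up_flow m i n / m n * grad_up i f n)"

text \<open>The differences point upwards, so the death part of the generator is
  \<open>- death f\<close>. Truncated subtraction only occurs where the factor \<open>n $ i\<close>
  is \<open>0\<close>.\<close>

definition death :: "(nat ^ 'd \<Rightarrow> real) \<Rightarrow> nat ^ 'd \<Rightarrow> real" where
  "death f n = (\<Sum>i\<in>UNIV. real (n $ i) * grad_up i f (n - axis i 1))"

definition gen :: "(nat ^ 'd \<Rightarrow> real) \<Rightarrow> nat ^ 'd \<Rightarrow> real" where
  "gen f n = birth f n - death f n"

definition energy :: "(nat ^ 'd \<Rightarrow> real) \<Rightarrow> (nat ^ 'd \<Rightarrow> real) \<Rightarrow> real" where
  "energy f g = (\<Sum>n\<in>S. \<Sum>i\<in>UNIV. up_flow m i n * grad_up i f n * grad_up i g n)"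

lemma sum_birth: "(\<Sum>n\<in>S. m n * (h n * birth f n)) = (\<Sum>n\<in>S. \<Sum>i\<in>UNIV. up_flow m i n * grad_up i f n * h n)"
proof (rule sum.cong[OF refl])
  fix n assume "n \<in> S"
  then have "m n \<noteq> 0" using pos by force
  then show "m n * (h n * birth f n) = (\<Sum>i\<in>UNIV. up_flow m i n * grad_up i f n * h n)"
    by (simp add: birth_def sum_distrib_left) (simp add: mult_ac)
qed

lemma sum_death:
  "(\<Sum>n\<in>S. m n * (h n * death f n)) =
   (\<Sum>n\<in>S. \<Sum>i\<in>UNIV. up_flow m i n * grad_up i f n * h (n + axis i 1))"
proof -
  have "(\<Sum>n\<in>S. m n * (h n * death f n)) =
      (\<Sum>i\<in>UNIV. \<Sum>n\<in>S. real (n $ i) * m n * (h n * grad_up i f (n - axis i 1)))"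
    by (subst sum.swap) (simp add: death_def sum_distrib_left mult_ac)
  also have "\<dots> = (\<Sum>i\<in>UNIV. \<Sum>n\<in>S. up_flow m i n * grad_up i f n * h (n + axis i 1))"
    unfolding sum_shift by (simp add: add_axis_diff mult_ac)
  finally show ?thesis by (simp add: sum.swap[of _ UNIV S])
qed

text \<open>Integration by parts: \<open>sum_death\<close> evaluates \<open>h\<close> one step above
  \<open>sum_birth\<close>, so their difference produces a gradient of \<open>h\<close>.\<close>

lemma green: "(\<Sum>n\<in>S. m n * (h n * gen f n)) = - energy f h"
proof -
  have "(\<Sum>n\<in>S. m n * (h n * gen f n)) =
      (\<Sum>n\<in>S. m n * (h n * birth f n)) - (\<Sum>n\<in>S. m n * (h n * death f n))"
    by (simp add: gen_def algebra_simps sum_subtractf)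
  also have "\<dots> = - energy f h"
    unfolding sum_birth sum_death energy_def
    by (simp add: grad_up_def[of _ h] algebra_simps sum_subtractf)
  finally show ?thesis .
qed

section \<open>The Bochner identity\<close>

lemma sum_birth_death:
  "(\<Sum>n\<in>S. m n * (birth f n * death f n)) =
   (\<Sum>n\<in>S. \<Sum>i\<in>UNIV. \<Sum>j\<in>UNIV. up_flow2 m i j n * (grad_up i f n * grad_up j f (n + axis i 1)))"
  unfolding sum_death
proof (intro sum.cong refl)
  fix n i
  have "up_flow m i n * grad_up i f n * birth f (n + axis i 1) =
      (\<Sum>j\<in>UNIV. (up_flow m i n * (up_flow m j (n + axis i 1) / m (n + axis i 1))) *
        (grad_up i f n * grad_up j f (n + axis i 1)))"
    by (simp add: birth_def sum_distrib_left mult_ac)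
  then show "up_flow m i n * grad_up i f n * birth f (n + axis i 1) =
      (\<Sum>j\<in>UNIV. up_flow2 m i j n * (grad_up i f n * grad_up j f (n + axis i 1)))"
    by (simp only: up_flow_divide)
qed

text \<open>Apply \<open>sum_death\<close> with \<open>death f\<close> as \<open>h\<close>, then
  shift each inner death term again. At \<open>n + axis i 1\<close> the death rate in direction
  \<open>i\<close> is \<open>n $ i + 1\<close>; the excess \<open>1\<close> is the source of
  \<open>energy f f\<close>.\<close>

lemma sum_death_death:
  "(\<Sum>n\<in>S. m n * (death f n * death f n)) =
   (\<Sum>n\<in>S. \<Sum>i\<in>UNIV. \<Sum>j\<in>UNIV.
      up_flow2 m i j n * (grad_up i f (n + axis j 1) * grad_up j f (n + axis i 1))) + energy f f"
proof -
  have split: "up_flow m i n * grad_up i f n * death f (n + axis i 1) =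
      (\<Sum>j\<in>UNIV. real (n $ j) * m n *
         (up_flow m i n / m n * grad_up i f n * grad_up j f (n - axis j 1 + axis i 1))) +
      up_flow m i n * grad_up i f n * grad_up i f n" if "n \<in> S" for n i
  proof -
    have "real ((n + axis i 1) $ j) * grad_up j f (n + axis i 1 - axis j 1) =
        real (n $ j) * grad_up j f (n - axis j 1 + axis i 1) +
        (if j = i then grad_up i f n else 0)" for j
    proof -
      have "n + axis i 1 - axis j 1 = n - axis j 1 + axis i 1" if "0 < n $ j"
        using that by (auto simp: vec_eq_iff axis_def)
      then show ?thesis
        by (cases "n $ j = 0") (auto simp: add_axis_diff axis_def algebra_simps)
    qed
    moreover have "m n \<noteq> 0" using pos that by force
    ultimately show ?thesis
      by (simp add: death_def sum.distrib sum_distrib_left distrib_left) (simp add: mult_ac)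
  qed
  have "(\<Sum>n\<in>S. m n * (death f n * death f n)) =
      (\<Sum>n\<in>S. \<Sum>i\<in>UNIV. \<Sum>j\<in>UNIV. real (n $ j) * m n *
         (up_flow m i n / m n * grad_up i f n * grad_up j f (n - axis j 1 + axis i 1))) +
      energy f f"
    unfolding sum_death energy_def
    by (simp only: split sum.distrib cong: sum.cong)
  also have "(\<Sum>n\<in>S. \<Sum>i\<in>UNIV. \<Sum>j\<in>UNIV. real (n $ j) * m n *
         (up_flow m i n / m n * grad_up i f n * grad_up j f (n - axis j 1 + axis i 1))) =
      (\<Sum>i\<in>UNIV. \<Sum>j\<in>UNIV. \<Sum>n\<in>S. real (n $ j) * m n *
         (up_flow m i n / m n * grad_up i f n * grad_up j f (n - axis j 1 + axis i 1)))"
    by (simp add: sum.swap[of _ S UNIV])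
  also have "\<dots> = (\<Sum>i\<in>UNIV. \<Sum>j\<in>UNIV. \<Sum>n\<in>S.
      up_flow m j n * (up_flow m i (n + axis j 1) / m (n + axis j 1)) *
      (grad_up i f (n + axis j 1) * grad_up j f (n + axis i 1)))"
    unfolding sum_shift by (simp add: add_axis_diff mult_ac)
  also have "\<dots> = (\<Sum>n\<in>S. \<Sum>i\<in>UNIV. \<Sum>j\<in>UNIV.
      up_flow2 m i j n * (grad_up i f (n + axis j 1) * grad_up j f (n + axis i 1)))"
    unfolding up_flow_divide by (subst up_flow2_commute) (simp add: sum.swap[of _ S UNIV])
  finally show ?thesis .
qed

lemma bochner:
  "(\<Sum>n\<in>S. m n * (gen f n)\<^sup>2) =
   (\<Sum>n\<in>S. \<Sum>i\<in>UNIV. \<Sum>j\<in>UNIV.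
      (up_flow m i n * up_flow m j n / m n - up_flow2 m i j n) * (grad_up i f n * grad_up j f n)) +
   energy f f +
   (\<Sum>n\<in>S. \<Sum>i\<in>UNIV. \<Sum>j\<in>UNIV.
      up_flow2 m i j n * (grad_up i f (n + axis j 1) - grad_up i f n)\<^sup>2)"
proof -
  have bb: "(\<Sum>n\<in>S. m n * (birth f n * birth f n)) = (\<Sum>n\<in>S. \<Sum>i\<in>UNIV. \<Sum>j\<in>UNIV.
      up_flow m i n * up_flow m j n / m n * (grad_up i f n * grad_up j f n))"
    unfolding sum_birth by (simp add: birth_def sum_distrib_left mult_ac)
  have bd: "(\<Sum>n\<in>S. m n * (birth f n * death f n)) =
   (\<Sum>n\<in>S. \<Sum>i\<in>UNIV. \<Sum>j\<in>UNIV. up_flow2 m i j n * (grad_up j f n * grad_up i f (n + axis j 1)))"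
    unfolding sum_birth_death by (subst sum.swap, subst up_flow2_commute) (rule refl)
  have pt: "up_flow2 m i j n * (grad_up i f (n + axis j 1) - grad_up i f n)\<^sup>2 =
     up_flow2 m i j n * (grad_up i f n * grad_up j f n)
     - up_flow2 m i j n * (grad_up i f n * grad_up j f (n + axis i 1))
     - up_flow2 m i j n * (grad_up j f n * grad_up i f (n + axis j 1))
     + up_flow2 m i j n * (grad_up i f (n + axis j 1) * grad_up j f (n + axis i 1))" for n i j
  proof -
    have "(grad_up i f (n + axis j 1) - grad_up i f n)\<^sup>2 =
      (grad_up i f (n + axis j 1) - grad_up i f n) * (grad_up j f (n + axis i 1) - grad_up j f n)"
      by (simp only: power2_eq_square grad_up_shift[of j])
    then show ?thesis by (simp only:) (simp add: algebra_simps)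
  qed
  have "(\<Sum>n\<in>S. m n * (gen f n)\<^sup>2) = (\<Sum>n\<in>S. m n * (birth f n * birth f n)) -
      (\<Sum>n\<in>S. m n * (birth f n * death f n)) - (\<Sum>n\<in>S. m n * (birth f n * death f n)) +
      (\<Sum>n\<in>S. m n * (death f n * death f n))"
    by (simp add: gen_def power2_eq_square algebra_simps sum_distrib_left flip: sum.distrib sum_subtractf)
  also note bb
  \<comment> \<open>The two equal cross terms are written with \<open>i\<close> and \<open>j\<close>
    interchanged, to match the two mixed products in \<open>pt\<close>.\<close>
  also have "\<And>x y. x - (\<Sum>n\<in>S. m n * (birth f n * death f n)) - (\<Sum>n\<in>S. m n * (birth f n * death f n)) + y =
    x - (\<Sum>n\<in>S. \<Sum>i\<in>UNIV. \<Sum>j\<in>UNIV. up_flow2 m i j n * (grad_up i f n * grad_up j f (n + axis i 1)))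
    - (\<Sum>n\<in>S. \<Sum>i\<in>UNIV. \<Sum>j\<in>UNIV. up_flow2 m i j n * (grad_up j f n * grad_up i f (n + axis j 1))) + y"
    using bd sum_birth_death[of f] by simp
  also note sum_death_death
  finally show ?thesis
    unfolding pt by (simp add: sum.distrib sum_subtractf left_diff_distrib)
qed

text \<open>The last sum in \<open>bochner\<close> is nonnegative, and \<open>curved\<close> with
  \<open>grad_up i f n\<close> as \<open>u i\<close> bounds the first one below by
  \<open>(\<delta> - 1) * energy f f\<close>.\<close>

lemma energy_le_gen:
  assumes "\<And>n. n \<in> S \<Longrightarrow> curved \<delta> m n"
  shows "\<delta> * energy f f \<le> (\<Sum>n\<in>S. m n * (gen f n)\<^sup>2)"
proof -
  have "0 \<le> (\<Sum>n\<in>S. \<Sum>i\<in>UNIV. \<Sum>j\<in>UNIV.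
      up_flow2 m i j n * (grad_up i f (n + axis j 1) - grad_up i f n)\<^sup>2)"
    by (intro sum_nonneg mult_nonneg_nonneg) (auto simp: up_flow2_def up_flow_nonneg)
  moreover have "0 \<le> (\<Sum>n\<in>S. (\<Sum>i\<in>UNIV. \<Sum>j\<in>UNIV.
      (up_flow m i n * up_flow m j n / m n - up_flow2 m i j n) * (grad_up i f n * grad_up j f n)) +
      (1 - \<delta>) * (\<Sum>i\<in>UNIV. up_flow m i n * (grad_up i f n)\<^sup>2))"
    by (intro sum_nonneg) (use assms in \<open>auto simp: curved_def\<close>)
  then have "0 \<le> (\<Sum>n\<in>S. \<Sum>i\<in>UNIV. \<Sum>j\<in>UNIV.
      (up_flow m i n * up_flow m j n / m n - up_flow2 m i j n) * (grad_up i f n * grad_up j f n)) +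
      (1 - \<delta>) * energy f f"
    by (simp add: sum.distrib energy_def power2_eq_square mult.assoc flip: sum_distrib_left)
  ultimately show ?thesis unfolding bochner by (simp add: algebra_simps)
qed

section \<open>The Poincare inequality on finite down-sets\<close>

lemma energy_nonneg: "0 \<le> energy f f"
  unfolding energy_def
  by (intro sum_nonneg) (simp add: mult.assoc up_flow_nonneg)

text \<open>A value outside \<open>S\<close> is only reached through a zero flow. This permits
  cutting functions off outside \<open>S\<close>.\<close>

lemma energy_cong:
  assumes "\<And>n. n \<in> S \<Longrightarrow> f n = g n"
  shows "energy f f = energy g g"
proof -
  have "up_flow m i n * grad_up i f n * grad_up i f n = up_flow m i n * grad_up i g n * grad_up i g n"
    if "n \<in> S" for i n
    using assms that by (cases "n + axis i 1 \<in> S") (auto simp: grad_up_def up_flow_def zero)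
  then show ?thesis unfolding energy_def by (intro sum.cong refl)
qed

lemma energy_scale: "energy (\<lambda>n. c * f n) (\<lambda>n. c * f n) = c\<^sup>2 * energy f f"
  by (simp add: energy_def grad_up_def sum_distrib_left power2_eq_square algebra_simps)

lemma energy_shift: "energy (\<lambda>n. f n - c) (\<lambda>n. f n - c) = energy f f"
  by (simp add: energy_def grad_up_def)

lemma energy_add:
  "energy (\<lambda>n. f n + t * h n) (\<lambda>n. f n + t * h n) =
   energy f f + 2 * t * energy f h + t\<^sup>2 * energy h h"
  by (simp add: energy_def grad_up_def sum_distrib_left power2_eq_square algebra_simps
      flip: sum.distrib)

text \<open>Every point of \<open>S\<close> descends to \<open>0\<close> inside \<open>S\<close> by
  unit steps. Each step carries positive flow, so zero energy makes \<open>f\<close> constant along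
  it.\<close>

lemma energy_0_imp_const:
  assumes "energy f f = 0" "n \<in> S"
  shows "f n = f 0"
  using assms(2)
proof (induction "\<Sum>i\<in>UNIV. n $ i" arbitrary: n rule: less_induct)
  case less
  show ?case
  proof (cases "n = 0")
    case False
    then obtain i where i: "0 < n $ i" by (auto simp: vec_eq_iff)
    let ?p = "n - axis i 1"
    have p: "?p + axis i 1 = n" by (rule diff_axis_add[OF i])
    have pS: "?p \<in> S" using less.prems down_axis[of ?p i] p by simp
    have "(\<Sum>i\<in>UNIV. ?p $ i) < (\<Sum>i\<in>UNIV. n $ i)"
      using i by (intro sum_strict_mono_ex1) (auto simp: axis_def)
    then have IH: "f ?p = f 0" using pS by (rule less.hyps)
    have "(\<Sum>i\<in>UNIV. up_flow m i ?p * grad_up i f ?p * grad_up i f ?p) = 0"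
      using assms(1) pS finite_S unfolding energy_def
      by (subst (asm) sum_nonneg_eq_0_iff) (auto intro!: sum_nonneg simp: mult.assoc up_flow_nonneg)
    then have "up_flow m i ?p * grad_up i f ?p * grad_up i f ?p = 0"
      by (subst (asm) sum_nonneg_eq_0_iff) (auto simp: mult.assoc up_flow_nonneg)
    moreover have "up_flow m i ?p > 0"
      using pos[OF less.prems] i unfolding up_flow_def p by simp
    ultimately have "grad_up i f ?p = 0" by simp
    then show ?thesis using IH p by (simp add: grad_up_def)
  qed simp
qed

lemma poincare_centered:
  assumes curv: "\<And>n. n \<in> S \<Longrightarrow> curved \<delta> m n"
    and centered: "(\<Sum>n\<in>S. m n * f n) = 0"
  shows "\<delta> * (\<Sum>n\<in>S. m n * (f n)\<^sup>2) \<le> energy f f"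
proof (cases "(\<Sum>n\<in>S. m n * (f n)\<^sup>2) = 0")
  case True
  show ?thesis unfolding True by (simp add: energy_nonneg)
next
  case False
  define Q where "Q h = (\<Sum>n\<in>S. m n * (h n)\<^sup>2)" for h
  define M where "M h = (\<Sum>n\<in>S. m n * h n)" for h
  \<comment> \<open>The unit sphere of centred functions vanishing off \<open>S\<close>. On
    \<open>S\<close> the box bounds follow from \<open>Q h = 1\<close>; off \<open>S\<close> they
    force the value \<open>0\<close>, since \<open>1 / 0 = 0\<close>. The box is compact in the
    product topology by Tychonoff.\<close>
  define K where "K = PiE UNIV (\<lambda>n. {- sqrt (1 / m n)..sqrt (1 / m n)}) \<inter> {h. M h = 0} \<inter> {h. Q h = 1}"
  have Q_nonneg: "0 \<le> Q h" for h
    unfolding Q_def by (intro sum_nonneg) (simp add: nonneg)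
  define nrm where "nrm h n = (if n \<in> S then h n / sqrt (Q h) else 0)" for h n
  have nrm: "nrm h \<in> K" "energy (nrm h) (nrm h) = energy h h / Q h" if h: "M h = 0" "Q h \<noteq> 0" for h
  proof -
    have Qp: "0 < Q h" using Q_nonneg[of h] h by linarith
    have 1: "M (nrm h) = 0"
      using h(1) by (simp add: M_def nrm_def flip: sum_divide_distrib)
    have 2: "Q (nrm h) = 1"
    proof -
      have "Q (nrm h) = Q h / Q h"
        using Qp unfolding Q_def[of "nrm h"] nrm_def
        by (simp add: power_divide flip: sum_divide_distrib) (simp add: Q_def)
      then show ?thesis using Qp by simp
    qed
    have 3: "\<bar>nrm h n\<bar> \<le> sqrt (1 / m n)" for n
    proof (cases "n \<in> S")
      case True
      have "m n * (nrm h n)\<^sup>2 \<le> Q (nrm h)"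
        unfolding Q_def by (rule member_le_sum[OF True]) (auto simp: nonneg finite_S)
      then have "(nrm h n)\<^sup>2 \<le> 1 / m n"
        using pos[OF True] 2 by (simp add: field_simps)
      then show ?thesis by (simp add: real_le_rsqrt)
    qed (simp add: nrm_def zero)
    show "nrm h \<in> K"
      using 1 2 3 by (simp add: K_def PiE_iff abs_le_iff minus_le_iff)
    have "energy (nrm h) (nrm h) = energy (\<lambda>n. (1 / sqrt (Q h)) * h n) (\<lambda>n. (1 / sqrt (Q h)) * h n)"
      by (rule energy_cong) (simp add: nrm_def)
    also have "\<dots> = energy h h / Q h"
      unfolding energy_scale using Qp by (simp add: power_divide)
    finally show "energy (nrm h) (nrm h) = energy h h / Q h" .
  qed
  have "compact (PiE UNIV (\<lambda>n. {- sqrt (1 / m n)..sqrt (1 / m n)}))"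
    by (subst compactin_euclidean_iff[symmetric], subst euclidean_product_topology[symmetric])
      (simp add: compactin_PiE)
  moreover have "closed {h. M h = 0}" "closed {h. Q h = 1}"
    unfolding M_def Q_def by (intro closed_Collect_eq continuous_intros continuous_on_product_coordinates)+
  ultimately have "compact K" unfolding K_def by (intro compact_Int_closed)
  moreover have "K \<noteq> {}"
    using nrm(1)[of f] centered False by (auto simp: M_def Q_def)
  moreover have "continuous_on K (\<lambda>h. energy h h)"
    unfolding energy_def grad_up_def
    by (intro continuous_intros continuous_on_subset[OF continuous_on_product_coordinates]) auto
  ultimately have "\<exists>g\<in>K. \<forall>h\<in>K. energy g g \<le> energy h h"
    by (rule continuous_attains_inf)
  then obtain g where g: "g \<in> K" "\<And>h. h \<in> K \<Longrightarrow> energy g g \<le> energy h h" by blast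
  define \<kappa> where "\<kappa> = energy g g"
  have Mg: "M g = 0" and Qg: "Q g = 1" using g(1) unfolding K_def by simp_all
  have min: "\<kappa> * Q h \<le> energy h h" if "M h = 0" for h
  proof (cases "Q h = 0")
    case False
    have "\<kappa> \<le> energy (nrm h) (nrm h)" unfolding \<kappa>_def by (intro g(2) nrm(1) that False)
    then have "\<kappa> \<le> energy h h / Q h" by (simp only: nrm(2)[OF that False])
    then show ?thesis using Q_nonneg[of h] False by (simp add: field_simps)
  qed (simp add: energy_nonneg)
  \<comment> \<open>The first variation at the minimiser: the weak form of
    \<open>- gen g = \<kappa> g\<close>, against centred \<open>h\<close>.\<close>
  have EL: "energy g h = \<kappa> * (\<Sum>n\<in>S. m n * (g n * h n))" if h: "M h = 0" for h
  proof -
    define B where "B = energy g h - \<kappa> * (\<Sum>n\<in>S. m n * (g n * h n))"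
    define C where "C = energy h h - \<kappa> * Q h"
    have quad: "0 \<le> 2 * t * B + t\<^sup>2 * C" for t
    proof -
      have "M (\<lambda>n. g n + t * h n) = M g + t * M h"
        by (simp add: M_def algebra_simps sum.distrib sum_distrib_left)
      then have "\<kappa> * Q (\<lambda>n. g n + t * h n) \<le> energy g g + 2 * t * energy g h + t\<^sup>2 * energy h h"
        using min[of "\<lambda>n. g n + t * h n"] Mg h by (simp add: energy_add)
      moreover have "Q (\<lambda>n. g n + t * h n) = Q g + 2 * t * (\<Sum>n\<in>S. m n * (g n * h n)) + t\<^sup>2 * Q h"
        by (simp add: Q_def power2_eq_square sum_distrib_left algebra_simps flip: sum.distrib)
      ultimately show ?thesis
        using Qg by (simp add: B_def C_def algebra_simps flip: \<kappa>_def)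
    qed
    have "C \<ge> 0" using min[OF h] by (simp add: C_def)
    \<comment> \<open>With this \<open>t\<close>, \<open>2 * t * B + t\<^sup>2 * C\<close> equals
      \<open>- t\<^sup>2 * (C + 2)\<close>, so \<open>quad\<close> forces \<open>t = 0\<close> and
      hence \<open>B = 0\<close>. Dividing by \<open>C + 1\<close> instead of \<open>C\<close>
      covers \<open>C = 0\<close>.\<close>
    define t where "t = - B / (C + 1)"
    have t: "t * (C + 1) = - B" using \<open>C \<ge> 0\<close> by (simp add: t_def)
    have "t\<^sup>2 * (C + 2) = - (2 * t * B + t\<^sup>2 * C)"
      using t by algebra
    also have "\<dots> \<le> 0" using quad[of t] by simp
    finally have "t\<^sup>2 = 0" using \<open>C \<ge> 0\<close> by (simp add: mult_le_0_iff)
    then show ?thesis using t by (simp add: B_def)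
  qed
  \<comment> \<open>Testing \<open>green\<close> with the constant \<open>1\<close> shows that
    \<open>gen g\<close> is centred, so it is admissible in \<open>EL\<close>. Two further uses of
    \<open>green\<close> then give \<open>\<kappa> * \<kappa>\<close>.\<close>
  have "energy g (\<lambda>n. 1) = 0" by (simp add: energy_def grad_up_def)
  then have "M (gen g) = 0" using green[of "\<lambda>n. 1" g] by (simp add: M_def)
  from EL[OF this] have "(\<Sum>n\<in>S. m n * (gen g n)\<^sup>2) = \<kappa> * \<kappa>"
    using green[of "gen g" g] green[of g g] by (simp add: power2_eq_square \<kappa>_def)
  with energy_le_gen[OF curv, of g] have "\<delta> * \<kappa> \<le> \<kappa> * \<kappa>" by (simp add: \<kappa>_def)
  \<comment> \<open>Allows cancelling one factor \<open>\<kappa>\<close>: zero energy would make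
    \<open>g\<close> constant on \<open>S\<close>, and being centred it would have
    \<open>Q g = 0\<close>.\<close>
  moreover have "\<kappa> \<noteq> 0"
  proof
    assume "\<kappa> = 0"
    then have const: "g n = g 0" if "n \<in> S" for n
      using energy_0_imp_const[OF _ that] by (simp add: \<kappa>_def)
    have "0 = g 0 * M g" using Mg by simp
    also have "\<dots> = (\<Sum>n\<in>S. m n * (g 0 * g n))"
      by (simp add: M_def sum_distrib_left mult_ac)
    also have "\<dots> = Q g"
      unfolding Q_def power2_eq_square by (intro sum.cong refl) (simp add: const)
    finally show False using Qg by simp
  qed
  moreover have "\<kappa> \<ge> 0" by (simp add: \<kappa>_def energy_nonneg)
  ultimately have "\<delta> \<le> \<kappa>" by simp
  then have "\<delta> * Q f \<le> \<kappa> * Q f" using Q_nonneg by (rule mult_right_mono)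
  also have "\<dots> \<le> energy f f" using centered by (intro min) (simp add: M_def)
  finally show ?thesis by (simp add: Q_def)
qed

text \<open>Subtract the mean and use \<open>poincare_centered\<close>. Multiplying through by the
  total mass lets truncations of a pmf be used without renormalising.\<close>

lemma poincare:
  assumes "\<And>n. n \<in> S \<Longrightarrow> curved \<delta> m n"
  shows "\<delta> * ((\<Sum>n\<in>S. m n) * (\<Sum>n\<in>S. m n * (f n)\<^sup>2) - (\<Sum>n\<in>S. m n * f n)\<^sup>2) \<le>
    (\<Sum>n\<in>S. m n) * energy f f"
proof (cases "S = {}")
  case False
  define Z a where "Z = (\<Sum>n\<in>S. m n)" and "a = (\<Sum>n\<in>S. m n * f n) / Z"
  have Z: "0 < Z" unfolding Z_def using False finite_S pos by (intro sum_pos) auto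
  have aZ: "(\<Sum>n\<in>S. m n * f n) = a * Z" using Z by (simp add: a_def)
  have "(\<Sum>n\<in>S. m n * (f n - a)) = (\<Sum>n\<in>S. m n * f n) - a * Z"
    by (simp add: Z_def algebra_simps sum_subtractf sum_distrib_left)
  then have "\<delta> * (\<Sum>n\<in>S. m n * (f n - a)\<^sup>2) \<le> energy f f"
    using poincare_centered[OF assms, of "\<lambda>n. f n - a"] by (simp add: energy_shift aZ)
  moreover have "(\<Sum>n\<in>S. m n * (f n - a)\<^sup>2) =
      (\<Sum>n\<in>S. m n * (f n)\<^sup>2) - 2 * a * (\<Sum>n\<in>S. m n * f n) + a\<^sup>2 * Z"
    unfolding Z_def
    by (simp add: power2_eq_square algebra_simps sum_subtractf sum.distrib sum_distrib_left)
  moreover have "\<dots> = (\<Sum>n\<in>S. m n * (f n)\<^sup>2) - a\<^sup>2 * Z"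
    by (simp add: aZ power2_eq_square)
  ultimately have "\<delta> * ((\<Sum>n\<in>S. m n * (f n)\<^sup>2) - a\<^sup>2 * Z) \<le> energy f f"
    by simp
  then have "Z * (\<delta> * ((\<Sum>n\<in>S. m n * (f n)\<^sup>2) - a\<^sup>2 * Z)) \<le> Z * energy f f"
    using Z by (intro mult_left_mono) auto
  then show ?thesis
    unfolding Z_def[symmetric] aZ by (simp add: power2_eq_square algebra_simps)
qed simp

end

section \<open>Truncation to simplices and the curvature of ULC measures\<close>

definition coord_sum :: "nat ^ 'd::finite \<Rightarrow> nat" where
  "coord_sum n = (\<Sum>i\<in>UNIV. n $ i)"

text \<open>Cutting by \<open>coord_sum\<close> makes all two-step neighbours of a point leave
  together, so at each point \<open>up_flow2\<close> is either unchanged for all pairs of directions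
  or \<open>0\<close> for all.\<close>

definition truncate :: "nat \<Rightarrow> (nat ^ 'd::finite \<Rightarrow> real) \<Rightarrow> nat ^ 'd \<Rightarrow> real" where
  "truncate k m n = (if coord_sum n \<le> k then m n else 0)"

lemma coord_sum_add_axis: "coord_sum (n + axis i 1) = Suc (coord_sum n)"
  by (simp add: coord_sum_def sum.distrib axis_def)

lemma coord_sum_mono: "m \<le> n \<Longrightarrow> coord_sum m \<le> coord_sum n"
  by (simp add: coord_sum_def less_eq_vec_def sum_mono)

lemma finite_coord_sum_le: "finite {n :: nat ^ 'd::finite. coord_sum n \<le> k}"
proof (rule finite_subset)
  show "{n :: nat ^ 'd. coord_sum n \<le> k} \<subseteq> vec_lambda ` (PiE UNIV (\<lambda>_. {..k}))"
  proof
    fix n :: "nat ^ 'd" assume n: "n \<in> {n. coord_sum n \<le> k}"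
    have "n $ i \<le> coord_sum n" for i
      unfolding coord_sum_def by (rule member_le_sum) auto
    then have "vec_nth n \<in> PiE UNIV (\<lambda>_. {..k})"
      using n by (auto simp: PiE_iff intro: order_trans)
    then show "n \<in> vec_lambda ` (PiE UNIV (\<lambda>_. {..k}))"
      by (metis image_eqI vec_nth_inverse)
  qed
qed (intro finite_imageI finite_PiE, auto)

lemma ulc_imp_curved:
  fixes \<mu> :: "(nat ^ 'd::finite) pmf"
  assumes ulc: "ulc \<delta> \<mu>" and n: "n \<in> set_pmf \<mu>"
  shows "curved \<delta> (pmf \<mu>) n"
  unfolding curved_def
proof
  fix u :: "'d \<Rightarrow> real"
  let ?m = "pmf \<mu>"
  let ?c = "\<lambda>i. up_flow ?m i n"
  let ?t = "\<lambda>i j. (?c i * ?c j / ?m n - up_flow2 ?m i j n) * (u i * u j) +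
     (if i = j then (1 - \<delta>) * (?c i * (u i)\<^sup>2) else 0)"
  let ?I = "up_dirs \<mu> n"
  \<comment> \<open>All weights in the ULC matrix at \<open>n\<close> share the factor
    \<open>F n\<close>, which cancels and leaves only \<open>pmf \<mu> n\<close>,
    \<open>up_flow\<close> and \<open>up_flow2\<close>.\<close>
  define F where "F n = (\<Prod>i\<in>UNIV. fact (n $ i) :: real)" for n :: "nat ^ 'd"
  have F_pos: "0 < F n" for n by (simp add: F_def prod_pos)
  have F_add: "F (n + axis i 1) = (real (n $ i) + 1) * F n" for n i
  proof -
    have "fact ((n + axis i 1) $ j) = (if j = i then real (n $ i) + 1 else 1) * (fact (n $ j) :: real)" for j
      by (simp add: axis_def)
    then show ?thesis by (simp add: F_def prod.distrib)
  qed
  have w: "weight \<mu> n = F n * ?m n" for n by (simp add: weight_def F_def)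
  have w1: "weight \<mu> (n + axis i 1) = F n * up_flow ?m i n" for n i
    unfolding w F_add by (simp add: up_flow_def)
  have w2: "weight \<mu> (n + axis i 1 + axis j 1) = F n * up_flow2 ?m i j n" for i j
    unfolding w1 F_add by (simp add: up_flow2_def)
  have mpos: "0 < ?m n" using n by (simp add: pmf_positive)
  have cpos: "0 < ?c i" if "i \<in> ?I" for i
    using that by (simp add: up_dirs_def up_flow_def pmf_positive)
  have c0: "?c i = 0" if "i \<notin> ?I" for i
    using that by (simp add: up_dirs_def up_flow_def set_pmf_iff)
  have c20: "up_flow2 ?m i j n = 0" if "i \<notin> ?I" for i j
  proof -
    have "n + axis i 1 + axis j 1 \<notin> set_pmf \<mu>"
      using that ulc le_add_axis unfolding ulc_def downward_closed_def up_dirs_def by blast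
    then show ?thesis by (simp add: up_flow2_def up_flow_def set_pmf_iff)
  qed
  have t0: "?t i j = 0" if "i \<notin> ?I \<or> j \<notin> ?I" for i j
  proof -
    have "up_flow2 ?m i j n = 0" using that c20 up_flow2_commute[of ?m i j] by metis
    then show ?thesis using that c0 by auto
  qed
  let ?M = "\<lambda>i j. (1 - weight \<mu> n * weight \<mu> (n + axis i 1 + axis j 1) /
               (weight \<mu> (n + axis i 1) * weight \<mu> (n + axis j 1))) +
        (1 - \<delta>) * (if i = j then weight \<mu> n / weight \<mu> (n + axis i 1) else 0)"
  have "psd_on ?I ?M" using ulc n unfolding ulc_def by blast
  \<comment> \<open>The test vector \<open>?c i * u i\<close> clears the denominators of
    \<open>?M\<close>.\<close>
  then have "0 \<le> (\<Sum>i\<in>?I. \<Sum>j\<in>?I. (?c i * u i) * ?M i j * (?c j * u j))"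
    unfolding psd_on_def by (elim conjE allE)
  also have "\<dots> = (\<Sum>i\<in>?I. \<Sum>j\<in>?I. ?m n * ?t i j)"
  proof (intro sum.cong refl)
    fix i j assume ij: "i \<in> ?I" "j \<in> ?I"
    note p = cpos[OF ij(1)] cpos[OF ij(2)] mpos F_pos[of n]
    show "(?c i * u i) * ?M i j * (?c j * u j) = ?m n * ?t i j"
      unfolding w2 unfolding w1 unfolding w
      using p by (auto simp: field_simps power2_eq_square)
  qed
  also have "\<dots> = ?m n * (\<Sum>i\<in>?I. \<Sum>j\<in>?I. ?t i j)"
    by (simp only: sum_distrib_left)
  also have "(\<Sum>i\<in>?I. \<Sum>j\<in>?I. ?t i j) = (\<Sum>i\<in>?I. \<Sum>j\<in>UNIV. ?t i j)"
    by (intro sum.cong refl sum.mono_neutral_left) (use t0 in auto)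
  also have "\<dots> = (\<Sum>i\<in>UNIV. \<Sum>j\<in>UNIV. ?t i j)"
    by (intro sum.mono_neutral_left sum.neutral ballI t0) auto
  finally have "0 \<le> (\<Sum>i\<in>UNIV. \<Sum>j\<in>UNIV. ?t i j)"
    using mpos by (simp add: zero_le_mult_iff)
  then show "0 \<le> (\<Sum>i\<in>UNIV. \<Sum>j\<in>UNIV. (?c i * ?c j / ?m n - up_flow2 ?m i j n) * (u i * u j)) +
     (1 - \<delta>) * (\<Sum>i\<in>UNIV. ?c i * (u i)\<^sup>2)"
    by (simp add: sum.distrib sum_distrib_left)
qed

text \<open>Up to level \<open>k - 2\<close> nothing changes. On the top two levels
  \<open>up_flow2\<close> vanishes and leaves a rank-one square; \<open>\<delta> \<le> 1\<close>
  makes the diagonal part nonnegative.\<close>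

lemma curved_truncate:
  fixes m :: "nat ^ 'd::finite \<Rightarrow> real"
  assumes "\<delta> \<le> 1" "curved \<delta> m n" "coord_sum n \<le> k" "\<And>n. 0 \<le> m n"
  shows "curved \<delta> (truncate k m) n"
proof (cases "coord_sum n + 2 \<le> k")
  case True
  then have "up_flow (truncate k m) i n = up_flow m i n"
    "up_flow2 (truncate k m) i j n = up_flow2 m i j n" "truncate k m n = m n" for i j
    by (simp_all add: up_flow2_def up_flow_def truncate_def coord_sum_add_axis del: One_nat_def)
  then show ?thesis using assms(2) by (simp add: curved_def)
next
  case False
  then have "up_flow2 (truncate k m) i j n = 0" for i j
    by (simp add: up_flow2_def up_flow_def truncate_def coord_sum_add_axis del: One_nat_def)
  then show ?thesis
    unfolding curved_def
  proof (intro allI)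
    fix u :: "'d \<Rightarrow> real"
    let ?c = "\<lambda>i. up_flow (truncate k m) i n"
    assume "\<And>i j. up_flow2 (truncate k m) i j n = 0"
    then have "(\<Sum>i\<in>UNIV. \<Sum>j\<in>UNIV.
        (?c i * ?c j / truncate k m n - up_flow2 (truncate k m) i j n) * (u i * u j)) =
      (\<Sum>i\<in>UNIV. ?c i * u i)\<^sup>2 / truncate k m n"
      by (simp add: power2_eq_square sum_product sum_divide_distrib mult_ac)
    moreover have "0 \<le> truncate k m n" "0 \<le> ?c i" for n i
      using assms(4) by (simp_all add: truncate_def up_flow_def)
    ultimately show "0 \<le> (\<Sum>i\<in>UNIV. \<Sum>j\<in>UNIV.
        (?c i * ?c j / truncate k m n - up_flow2 (truncate k m) i j n) * (u i * u j)) +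
        (1 - \<delta>) * (\<Sum>i\<in>UNIV. ?c i * (u i)\<^sup>2)"
      using assms(1) by (auto intro!: add_nonneg_nonneg mult_nonneg_nonneg sum_nonneg)
  qed
qed

section \<open>Bounded support for \<open>\<delta> > 1\<close>\<close>

text \<open>
  For \<open>\<delta> > 1\<close>, the birth rate in direction \<open>i\<close> drops by at least \<open>\<delta> - 1\<close> along every step
  on the \<open>i\<close>-th axis.
\<close>

lemma ulc_bounded_support:
  fixes \<mu> :: "(nat ^ 'd::finite) pmf"
  assumes ulc: "ulc \<delta> \<mu>" and \<delta>: "\<delta> > 1"
  obtains K where "\<And>n. n \<in> set_pmf \<mu> \<Longrightarrow> coord_sum n \<le> K"
proof -
  let ?m = "pmf \<mu>"
  define \<beta> where "\<beta> i n = up_flow ?m i n / ?m n" for i n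
  have dc: "m \<in> set_pmf \<mu>" if "n \<in> set_pmf \<mu>" "m \<le> n" for m n
    using ulc that unfolding ulc_def downward_closed_def by blast
  have axis_Suc: "axis i (Suc k) = axis i k + axis i 1" for i :: 'd and k
    by (simp add: vec_eq_iff axis_def)
  have drop: "\<beta> i (axis i k) \<le> \<beta> i 0 - real k * (\<delta> - 1)" if "axis i k \<in> set_pmf \<mu>" for i k
    using that
  proof (induction k)
    case (Suc k)
    let ?n = "axis i k :: nat ^ 'd"
    have n1: "?n + axis i 1 \<in> set_pmf \<mu>" using Suc.prems by (simp only: axis_Suc)
    then have n: "?n \<in> set_pmf \<mu>" using dc le_add_axis by blast
    have pos: "0 < ?m ?n" "0 < ?m (?n + axis i 1)" using n n1 by (simp_all only: pmf_positive)
    then have c: "0 < up_flow ?m i ?n" by (simp add: up_flow_def)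
    \<comment> \<open>\<open>curved\<close> tested with the indicator of \<open>i\<close>, which
      isolates the diagonal entry.\<close>
    have "0 \<le> (\<Sum>a\<in>UNIV. \<Sum>j\<in>UNIV. (up_flow ?m a ?n * up_flow ?m j ?n / ?m ?n - up_flow2 ?m a j ?n) *
        ((if a = i then 1 else 0) * (if j = i then 1 else 0))) +
        (1 - \<delta>) * (\<Sum>a\<in>UNIV. up_flow ?m a ?n * (if a = i then 1 else 0)\<^sup>2)"
      using ulc_imp_curved[OF ulc n] unfolding curved_def by (rule spec)
    also have "\<dots> = up_flow ?m i ?n * up_flow ?m i ?n / ?m ?n - up_flow2 ?m i i ?n + (1 - \<delta>) * up_flow ?m i ?n"
      by (simp add: if_distrib[of "\<lambda>x. _ * x"] if_distrib[of "\<lambda>x. x ^ 2"] cong: if_cong)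
    also have "up_flow2 ?m i i ?n = up_flow ?m i ?n * \<beta> i (?n + axis i 1)"
      using pos by (simp add: up_flow2_def \<beta>_def up_flow_def[of ?m i ?n])
    also have "up_flow ?m i ?n * up_flow ?m i ?n / ?m ?n = up_flow ?m i ?n * \<beta> i ?n"
      by (simp add: \<beta>_def)
    finally have "0 \<le> up_flow ?m i ?n * (\<beta> i ?n - \<beta> i (?n + axis i 1) + 1 - \<delta>)"
      by (simp add: algebra_simps)
    then have "\<beta> i (axis i (Suc k)) \<le> \<beta> i ?n - (\<delta> - 1)"
      using c by (simp only: axis_Suc zero_le_mult_iff) simp
    then show ?case using Suc.IH[OF n] by (simp add: algebra_simps)
  qed (simp add: vec_eq_iff axis_def flip: zero_vec_def)
  \<comment> \<open>Downward closure puts \<open>axis i (n $ i)\<close> in the support. Its rate is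
    nonnegative, so the linear decrease in \<open>drop\<close> bounds \<open>n $ i\<close>.\<close>
  have "n $ i \<le> nat \<lceil>\<beta> i 0 / (\<delta> - 1)\<rceil>" if n: "n \<in> set_pmf \<mu>" for n i
  proof -
    have "axis i (n $ i) \<in> set_pmf \<mu>" by (rule dc[OF n]) (simp add: less_eq_vec_def axis_def)
    then have "\<beta> i (axis i (n $ i)) \<le> \<beta> i 0 - real (n $ i) * (\<delta> - 1)" by (rule drop)
    moreover have "0 \<le> \<beta> i (axis i (n $ i))" by (simp add: \<beta>_def up_flow_def)
    ultimately have "real (n $ i) \<le> \<beta> i 0 / (\<delta> - 1)" using \<delta> by (simp add: field_simps)
    then show ?thesis by linarith
  qed
  then have "coord_sum n \<le> (\<Sum>i\<in>UNIV. nat \<lceil>\<beta> i 0 / (\<delta> - 1)\<rceil>)" if "n \<in> set_pmf \<mu>" for n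
    unfolding coord_sum_def using that by (intro sum_mono) auto
  then show ?thesis by (rule that)
qed

text \<open>For \<open>\<delta> \<le> 1\<close> every level works. For \<open>\<delta> > 1\<close>
  the sign argument of \<open>curved_truncate\<close> fails, but the support is bounded, so
  truncation at a level \<open>k \<ge> K\<close> changes nothing.\<close>

lemma ulc_truncate_curved:
  assumes ulc: "ulc \<delta> \<mu>"
  shows "\<exists>K. \<forall>k\<ge>K. \<forall>n\<in>set_pmf \<mu>. coord_sum n \<le> k \<longrightarrow> curved \<delta> (truncate k (pmf \<mu>)) n"
proof (cases "\<delta> \<le> 1")
  case True
  then show ?thesis by (intro exI[of _ 0]) (simp add: curved_truncate ulc_imp_curved[OF ulc])
next
  case False
  then obtain K where K: "\<And>n. n \<in> set_pmf \<mu> \<Longrightarrow> coord_sum n \<le> K"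
    using ulc_bounded_support[OF ulc] by auto
  then have "truncate k (pmf \<mu>) = pmf \<mu>" if "k \<ge> K" for k
    using that by (force simp: truncate_def set_pmf_iff)
  then show ?thesis by (intro exI[of _ K]) (simp add: ulc_imp_curved[OF ulc])
qed

section \<open>Passage to the limit\<close>

lemma sum_tendsto_expectation:
  fixes g :: "nat ^ 'd::finite \<Rightarrow> real"
  assumes int: "integrable (measure_pmf \<mu>) g"
  shows "(\<lambda>k. \<Sum>n\<in>{n\<in>set_pmf \<mu>. coord_sum n \<le> k}. pmf \<mu> n * g n) \<longlonglongrightarrow> measure_pmf.expectation \<mu> g"
proof -
  let ?S = "\<lambda>k. {n\<in>set_pmf \<mu>. coord_sum n \<le> k}"
  have "(\<lambda>k. measure_pmf.expectation \<mu> (\<lambda>n. if n \<in> ?S k then g n else 0)) \<longlonglongrightarrow>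
      measure_pmf.expectation \<mu> g"
  proof (rule integral_dominated_convergence[where w = "\<lambda>n. \<bar>g n\<bar>"])
    show "AE n in measure_pmf \<mu>. (\<lambda>k. if n \<in> ?S k then g n else 0) \<longlonglongrightarrow> g n"
    proof (rule AE_pmfI)
      fix n assume n: "n \<in> set_pmf \<mu>"
      have "\<forall>\<^sub>F k in sequentially. (if n \<in> ?S k then g n else 0) = g n"
        using eventually_ge_at_top[of "coord_sum n"] by eventually_elim (simp add: n)
      then show "(\<lambda>k. if n \<in> ?S k then g n else 0) \<longlonglongrightarrow> g n" by (rule tendsto_eventually)
    qed
  qed (use int in auto)
  moreover have "measure_pmf.expectation \<mu> (\<lambda>n. if n \<in> ?S k then g n else 0) =
      (\<Sum>n\<in>?S k. pmf \<mu> n * g n)" for k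
    by (subst integral_measure_pmf_real[of "?S k"])
      (auto simp: mult.commute intro: finite_subset[OF _ finite_coord_sum_le[of k]] split: if_splits)
  ultimately show ?thesis by simp
qed

lemma ulc_poincare:
  assumes ulc: "ulc \<delta> \<mu>" and f: "f \<in> energy_domain \<mu>"
  shows "\<delta> * measure_pmf.variance \<mu> f \<le> dirichlet \<mu> f f"
proof -
  let ?m = "pmf \<mu>"
  let ?S = "\<lambda>k. {n\<in>set_pmf \<mu>. coord_sum n \<le> k}"
  let ?E = "\<lambda>k g. \<Sum>n\<in>?S k. ?m n * g n"
  have f2: "integrable (measure_pmf \<mu>) (\<lambda>n. (f n)\<^sup>2)"
    and ed: "integrable (measure_pmf \<mu>) (energy_density \<mu> f f)"
    using f by (auto simp: energy_domain_def)
  have f1: "integrable (measure_pmf \<mu>) f"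
    by (rule measure_pmf.square_integrable_imp_integrable[OF _ f2]) simp
  obtain K where K: "\<And>k n. k \<ge> K \<Longrightarrow> n \<in> ?S k \<Longrightarrow> curved \<delta> (truncate k ?m) n"
    using ulc_truncate_curved[OF ulc] by auto
  have fin: "\<delta> * (?E k (\<lambda>_. 1) * ?E k (\<lambda>n. (f n)\<^sup>2) - (?E k f)\<^sup>2) \<le>
      ?E k (\<lambda>_. 1) * ?E k (energy_density \<mu> f f)" if k: "k \<ge> K" for k
  proof -
    interpret finite_weight "truncate k ?m" "?S k"
    proof
      show "finite (?S k)" by (rule finite_subset[OF _ finite_coord_sum_le[of k]]) auto
      show "downward_closed (?S k)"
        using ulc unfolding ulc_def downward_closed_def by (auto intro: order_trans[OF coord_sum_mono])
    qed (auto simp: truncate_def pmf_positive set_pmf_iff)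
    have tr: "(\<Sum>n\<in>?S k. truncate k ?m n * g n) = ?E k g" for g
      by (simp add: truncate_def)
    have tr1: "(\<Sum>n\<in>?S k. truncate k ?m n) = ?E k (\<lambda>_. 1)"
      by (simp add: truncate_def)
    \<comment> \<open>Only an inequality: truncation loses the flow from level \<open>k\<close> to
      level \<open>k + 1\<close>, which \<open>energy_density\<close> still counts.\<close>
    have "energy f f \<le> ?E k (energy_density \<mu> f f)"
      unfolding energy_def
    proof (rule sum_mono)
      fix n assume "n \<in> ?S k"
      then have "?m n \<noteq> 0" by (simp add: set_pmf_iff)
      then have "?m n * energy_density \<mu> f f n =
          (\<Sum>i\<in>UNIV. up_flow ?m i n * (grad_up i f n * grad_up i f n))"
        by (simp add: energy_density_def birth_rate_def up_flow_def sum_distrib_left mult_ac)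
      moreover have "up_flow (truncate k ?m) i n * (grad_up i f n * grad_up i f n) \<le>
          up_flow ?m i n * (grad_up i f n * grad_up i f n)" for i
        by (intro mult_right_mono) (auto simp: up_flow_def truncate_def)
      ultimately show "(\<Sum>i\<in>UNIV. up_flow (truncate k ?m) i n * grad_up i f n * grad_up i f n) \<le>
          ?m n * energy_density \<mu> f f n"
        by (simp add: mult.assoc sum_mono)
    qed
    then have "?E k (\<lambda>_. 1) * energy f f \<le> ?E k (\<lambda>_. 1) * ?E k (energy_density \<mu> f f)"
      by (intro mult_left_mono sum_nonneg) auto
    with poincare[of \<delta> f, OF K[OF k]] show ?thesis unfolding tr tr1 by linarith
  qed
  have lim1: "(\<lambda>k. ?E k (\<lambda>_. 1)) \<longlonglongrightarrow> 1"
    using sum_tendsto_expectation[of \<mu> "\<lambda>_. 1"] by simp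
  note lims = lim1 sum_tendsto_expectation[OF f1] sum_tendsto_expectation[OF f2]
    sum_tendsto_expectation[OF ed]
  \<comment> \<open>Each partial sum in \<open>fin\<close> converges separately, and the total mass
    of the truncations tends to \<open>1\<close>.\<close>
  have "\<delta> * (1 * measure_pmf.expectation \<mu> (\<lambda>n. (f n)\<^sup>2) - (measure_pmf.expectation \<mu> f)\<^sup>2) \<le>
      1 * measure_pmf.expectation \<mu> (energy_density \<mu> f f)"
  proof (rule LIMSEQ_le)
    show "(\<lambda>k. \<delta> * (?E k (\<lambda>_. 1) * ?E k (\<lambda>n. (f n)\<^sup>2) - (?E k f)\<^sup>2)) \<longlonglongrightarrow>
        \<delta> * (1 * measure_pmf.expectation \<mu> (\<lambda>n. (f n)\<^sup>2) - (measure_pmf.expectation \<mu> f)\<^sup>2)"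
      by (intro tendsto_intros lims)
    show "(\<lambda>k. ?E k (\<lambda>_. 1) * ?E k (energy_density \<mu> f f)) \<longlonglongrightarrow>
        1 * measure_pmf.expectation \<mu> (energy_density \<mu> f f)"
      by (intro tendsto_intros lims)
  qed (use fin in blast)
  then show ?thesis
    by (simp add: measure_pmf.variance_eq[OF f1 f2] dirichlet_def)
qed

theorem theorem3p6:
  fixes \<mu> :: "(nat ^ 'd::finite) pmf" and \<delta> :: real
  assumes "\<delta> > 0"
    and "ulc \<delta> \<mu>"
  shows "(\<forall>f\<in>energy_domain \<mu>.
            \<delta> * measure_pmf.variance \<mu> f \<le>
              measure_pmf.expectation \<mu> (\<lambda>n. \<Sum>i\<in>UNIV.
                (real (n $ i) + 1) * pmf \<mu> (n + axis i 1) / pmf \<mu> n * (grad_up i f n)\<^sup>2))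
         \<and> ereal \<delta> \<le> spectral_gap \<mu>"
proof
  have poincare: "\<forall>f\<in>energy_domain \<mu>. \<delta> * measure_pmf.variance \<mu> f \<le> dirichlet \<mu> f f"
    using ulc_poincare[OF assms(2)] by blast
  then show "ereal \<delta> \<le> spectral_gap \<mu>"
    unfolding spectral_gap_def by (intro Sup_upper) auto
  have "energy_density \<mu> f f = (\<lambda>n. \<Sum>i\<in>UNIV.
      (real (n $ i) + 1) * pmf \<mu> (n + axis i 1) / pmf \<mu> n * (grad_up i f n)\<^sup>2)" for f
    by (rule ext) (simp add: energy_density_def birth_rate_def power2_eq_square mult.assoc)
  with poincare show "\<forall>f\<in>energy_domain \<mu>. \<delta> * measure_pmf.variance \<mu> f \<le>
      measure_pmf.expectation \<mu> (\<lambda>n. \<Sum>i\<in>UNIV.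
        (real (n $ i) + 1) * pmf \<mu> (n + axis i 1) / pmf \<mu> n * (grad_up i f n)\<^sup>2)"
    by (simp add: dirichlet_def)
qed

end
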